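(* Suppose $G_{1}$ and $G_{2}$ are vertex disjoint finite simple undirected graphs. The independent neighborhood polynomial of their disjoint union $G_{1}\cup G_{2}$ satisfies $$N^{(i)}(G_{1}\cup G_{2},x)=N^{(i)}(G_{1},x)+N^{(i)}(G_{2},x)-1.$$
   Context: For a finite simple undirected graph $G=(V,E)$ and $v\in V$, the open neighborhood of $v$ is $N(v)=\{u \mid \{u,v\}\in E\}$. The independent neighborhood polynomial of a graph $G$ of order $n$ is $N^{(i)}(G,x)=\sum_{k=0}^{n} n_k^{(i)}(G)x^k$, where $n_k^{(i)}(G)$ is the number of independent vertex subsets $A\subseteq V$ of cardinality $k$ which are subsets of open neighborhoods in $G$, i.e. for which there exists $v\in V$ with $A\subseteq N(v)$. The disjoint union of $G_1=(V_1,E_1)$ and $G_2=(V_2,E_2)$ with disjoint vertex sets $V_1$ and $V_2$ is the graph $G_1\cup G_2$ with vertex set $V_1\cup V_2$ and edge set $E_1\cup E_2$.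
   Formalization: Both graphs are assumed to have at least one vertex: by the stated definition the graph with no vertices has independent neighborhood polynomial 0, and the identity then fails. *)

theory Defs
  imports "HOL-Computational_Algebra.Polynomial"
begin

text \<open>An undirected graph is a pair of a vertex set and a set of edges, where an edge is a
  two-element set of vertices.  The null graph (no vertices) is not excluded here.\<close>

type_synonym 'a ugraph = "'a set \<times> 'a set set"

abbreviation verts :: "'a ugraph \<Rightarrow> 'a set" where
  "verts G \<equiv> fst G"

abbreviation edges :: "'a ugraph \<Rightarrow> 'a set set" where
  "edges G \<equiv> snd G"

definition finite_simple_graph :: "'a ugraph \<Rightarrow> bool" where
  "finite_simple_graph G \<longleftrightarrow>
     finite (verts G) \<and> (\<forall>e\<in>edges G. e \<subseteq> verts G \<and> card e = 2)"

definition open_neighborhood :: "'a ugraph \<Rightarrow> 'a \<Rightarrow> 'a set" where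
  "open_neighborhood G v = {u. {u, v} \<in> edges G}"

definition independent_set :: "'a ugraph \<Rightarrow> 'a set \<Rightarrow> bool" where
  "independent_set G A \<longleftrightarrow> A \<subseteq> verts G \<and> (\<forall>u\<in>A. \<forall>v\<in>A. {u, v} \<notin> edges G)"

definition indep_nbhd_count :: "'a ugraph \<Rightarrow> nat \<Rightarrow> nat" where
  "indep_nbhd_count G k =
     card {A. independent_set G A \<and> card A = k \<and> (\<exists>v\<in>verts G. A \<subseteq> open_neighborhood G v)}"

definition indep_nbhd_poly :: "'a ugraph \<Rightarrow> int poly" where
  "indep_nbhd_poly G = (\<Sum>k = 0..card (verts G). monom (int (indep_nbhd_count G k)) k)"

definition graph_union :: "'a ugraph \<Rightarrow> 'a ugraph \<Rightarrow> 'a ugraph" where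
  "graph_union G1 G2 = (verts G1 \<union> verts G2, edges G1 \<union> edges G2)"

end

theory Submission
  imports Defs
begin

text \<open>The independent neighborhood polynomial is the generating function, by cardinality, of the
  family of independent sets that lie inside an open neighborhood
  (\<open>indep_nbhd_poly_eq_sum\<close>).  The identity is inclusion--exclusion for these families.
  In a disjoint union every neighborhood stays inside one part and is the same there as before, so
  the family of the union is the union of the two families (\<open>indep_nbhd_sets_graph_union\<close>).
  A common member is contained in both vertex sets, hence empty; and the empty set does belong to
  the family of every graph with a vertex.  Subtracting \<open>x\<^sup>0 = 1\<close> corrects for counting
  it twice.\<close>

definition indep_nbhd_sets :: "'a ugraph \<Rightarrow> 'a set set" where
  "indep_nbhd_sets G = {A. independent_set G A \<and> (\<exists>v\<in>verts G. A \<subseteq> open_neighborhood G v)}"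

lemma indep_nbhd_sets_subset_verts:
  assumes "A \<in> indep_nbhd_sets G"
  shows "A \<subseteq> verts G"
  using assms by (simp add: indep_nbhd_sets_def independent_set_def)

lemma finite_indep_nbhd_sets:
  assumes "finite (verts G)"
  shows "finite (indep_nbhd_sets G)"
  by (rule finite_subset[of _ "Pow (verts G)"]) (use indep_nbhd_sets_subset_verts[of _ G] assms in auto)

lemma empty_in_indep_nbhd_sets:
  assumes "verts G \<noteq> {}"
  shows "{} \<in> indep_nbhd_sets G"
  using assms by (auto simp: indep_nbhd_sets_def independent_set_def)

text \<open>Summing over the sets instead of over their sizes makes the polynomial additive in the
  family.  The members are grouped by cardinality, which never exceeds the order of the graph.\<close>

lemma indep_nbhd_poly_eq_sum:
  assumes "finite (verts G)"
  shows "indep_nbhd_poly G = (\<Sum>A\<in>indep_nbhd_sets G. monom 1 (card A))"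
proof -
  let ?F = "indep_nbhd_sets G"
  have "card ` ?F \<subseteq> {0..card (verts G)}"
    using card_mono[OF assms indep_nbhd_sets_subset_verts] by auto
  then have "(\<Sum>A\<in>?F. monom (1::int) (card A))
      = (\<Sum>k = 0..card (verts G). \<Sum>A\<in>{A \<in> ?F. card A = k}. monom 1 (card A))"
    using finite_indep_nbhd_sets[OF assms] by (intro sum.group[symmetric]) auto
  also have "\<dots> = (\<Sum>k = 0..card (verts G). monom (int (indep_nbhd_count G k)) k)"
  proof (rule sum.cong[OF refl])
    fix k
    have "{A \<in> ?F. card A = k}
        = {A. independent_set G A \<and> card A = k \<and> (\<exists>v\<in>verts G. A \<subseteq> open_neighborhood G v)}"
      by (auto simp: indep_nbhd_sets_def)
    then have count: "indep_nbhd_count G k = card {A \<in> ?F. card A = k}"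
      by (simp add: indep_nbhd_count_def)
    have "(\<Sum>A\<in>{A \<in> ?F. card A = k}. monom (1::int) (card A))
        = (\<Sum>A\<in>{A \<in> ?F. card A = k}. monom 1 k)"
      by (rule sum.cong) auto
    also have "\<dots> = monom (int (indep_nbhd_count G k)) k"
      by (simp add: count of_nat_poly smult_monom)
    finally show "(\<Sum>A\<in>{A \<in> ?F. card A = k}. monom 1 (card A))
        = monom (int (indep_nbhd_count G k)) k" .
  qed
  finally show ?thesis by (simp add: indep_nbhd_poly_def)
qed

lemma edge_ends_in_verts:
  assumes "finite_simple_graph G" and "{u, v} \<in> edges G"
  shows "u \<in> verts G" and "v \<in> verts G"
  using assms unfolding finite_simple_graph_def by blast+

lemma graph_union_commute: "graph_union G1 G2 = graph_union G2 G1"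
  by (simp add: graph_union_def Un_commute)

lemma open_neighborhood_graph_union:
  assumes "finite_simple_graph G2" and "verts G1 \<inter> verts G2 = {}" and "v \<in> verts G1"
  shows "open_neighborhood (graph_union G1 G2) v = open_neighborhood G1 v"
  using assms edge_ends_in_verts(2)[of G2 _ v]
  by (auto simp: open_neighborhood_def graph_union_def)

lemma independent_set_graph_union:
  assumes "finite_simple_graph G2" and "verts G1 \<inter> verts G2 = {}" and "A \<subseteq> verts G1"
  shows "independent_set (graph_union G1 G2) A \<longleftrightarrow> independent_set G1 A"
  using assms edge_ends_in_verts(1)[of G2]
  by (fastforce simp: independent_set_def graph_union_def)

text \<open>The neighborhood of a vertex of one summand has all its members in that summand, so independence
  of a subset of it can be tested there too.\<close>

lemma indep_nbhd_in_left_summand_iff: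
  assumes "finite_simple_graph G1" and "finite_simple_graph G2"
    and "verts G1 \<inter> verts G2 = {}" and "v \<in> verts G1"
  shows "independent_set (graph_union G1 G2) A \<and> A \<subseteq> open_neighborhood (graph_union G1 G2) v
    \<longleftrightarrow> independent_set G1 A \<and> A \<subseteq> open_neighborhood G1 v"
proof -
  have "open_neighborhood G1 v \<subseteq> verts G1"
    using edge_ends_in_verts(1)[OF assms(1)] by (auto simp: open_neighborhood_def)
  then show ?thesis
    using independent_set_graph_union[OF assms(2,3), of A]
      open_neighborhood_graph_union[OF assms(2-4)] by auto
qed

lemma indep_nbhd_sets_graph_union:
  assumes "finite_simple_graph G1" and "finite_simple_graph G2" and "verts G1 \<inter> verts G2 = {}"
  shows "indep_nbhd_sets (graph_union G1 G2) = indep_nbhd_sets G1 \<union> indep_nbhd_sets G2"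
proof -
  let ?U = "graph_union G1 G2"
  have verts: "verts ?U = verts G1 \<union> verts G2"
    by (simp add: graph_union_def)
  have left: "independent_set ?U A \<and> A \<subseteq> open_neighborhood ?U v
      \<longleftrightarrow> independent_set G1 A \<and> A \<subseteq> open_neighborhood G1 v" if "v \<in> verts G1" for A v
    using indep_nbhd_in_left_summand_iff[OF assms that] .
  have right: "independent_set ?U A \<and> A \<subseteq> open_neighborhood ?U v
      \<longleftrightarrow> independent_set G2 A \<and> A \<subseteq> open_neighborhood G2 v" if "v \<in> verts G2" for A v
    using indep_nbhd_in_left_summand_iff[OF assms(2,1) _ that] assms(3)
    by (simp add: graph_union_commute[of G1 G2] Int_commute)
  show ?thesis
    unfolding indep_nbhd_sets_def verts using left right by blast
qed

theorem theorem1: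
  fixes G1 G2 :: "'a ugraph"
  assumes "finite_simple_graph G1" and "finite_simple_graph G2"
    and "verts G1 \<noteq> {}" and "verts G2 \<noteq> {}"
    and "verts G1 \<inter> verts G2 = {}"
  shows "indep_nbhd_poly (graph_union G1 G2) = indep_nbhd_poly G1 + indep_nbhd_poly G2 - 1"
proof -
  let ?w = "\<lambda>A :: 'a set. monom (1::int) (card A)"
  have fin: "finite (verts G1)" "finite (verts G2)"
    using assms(1,2) by (auto simp: finite_simple_graph_def)
  then have "finite (verts (graph_union G1 G2))"
    by (simp add: graph_union_def)
  then have "indep_nbhd_poly (graph_union G1 G2)
      = sum ?w (indep_nbhd_sets G1 \<union> indep_nbhd_sets G2)"
    by (simp add: indep_nbhd_poly_eq_sum indep_nbhd_sets_graph_union[OF assms(1,2,5)])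
  also have "\<dots> = sum ?w (indep_nbhd_sets G1) + sum ?w (indep_nbhd_sets G2)
      - sum ?w (indep_nbhd_sets G1 \<inter> indep_nbhd_sets G2)"
    by (rule sum_Un) (simp_all add: fin finite_indep_nbhd_sets)
  also have "indep_nbhd_sets G1 \<inter> indep_nbhd_sets G2 = {{}}"
    using indep_nbhd_sets_subset_verts[of _ G1] indep_nbhd_sets_subset_verts[of _ G2]
      empty_in_indep_nbhd_sets[OF assms(3)] empty_in_indep_nbhd_sets[OF assms(4)] assms(5)
    by blast
  finally show ?thesis
    by (simp add: indep_nbhd_poly_eq_sum fin)
qed

end
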